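(* Consider the system of PDEs for $u(x,t)$, $v(x,t)$ $$(v_t+uv_x)_x=0,\qquad u_{xx}=v_x^2.$$ Let $(\xi,\tau)$ be characteristic coordinates for this system, with $x=X(\xi,\tau)$, $t=\tau$, and write $U(\xi,\tau)=u(X(\xi,\tau),\tau)$, $V(\xi,\tau)=v(X(\xi,\tau),\tau)$. Then a formal solution of the system is given by $$U = X_\tau,\qquad V = F + G,\qquad X = - \int_0^\xi\frac{F_{\xi}^2\,(A+B)^2}{2A_{\xi} B_\tau}\,d\xi + H,$$ where $A(\xi)$, $B(\tau)$, $F(\xi)$, $G(\tau)$, $H(\tau)$ are arbitrary functions.
   Context: Characteristic coordinates $(\xi,\tau)$ are coordinates with $t=\tau$ and $x_\tau=u$, i.e. $X_\tau(\xi,\tau)=u(X(\xi,\tau),\tau)$. Subscripts denote (partial) derivatives. "Formal solution" means: for smooth functions $A,F$ of $\xi$ (on an interval containing $0$) and $B,G,H$ of $\tau$ (on an interval) for which the expressions make sense ($A_\xi\neq0$, $B_\tau\neq0$) and for which the change of variables $(\xi,\tau)\mapsto(x,t)=(X(\xi,\tau),\tau)$ is smoothly invertible ($X_\xi\ne0$), the functions $u,v$ of $(x,t)$ determined by $u(X(\xi,\tau),\tau)=U(\xi,\tau)$, $v(X(\xi,\tau),\tau)=V(\xi,\tau)$ satisfy the system on the image of the change of variables. *)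

theory Defs
  imports "HOL-Analysis.Analysis"
begin

(* Meant for open S, where it says that f is C-infinity on S. *)
definition smooth_on :: "real set \<Rightarrow> (real \<Rightarrow> real) \<Rightarrow> bool" where
  "smooth_on S f \<longleftrightarrow> (\<forall>n. \<forall>x\<in>S. ((deriv ^^ n) f) field_differentiable (at x))"

(* Functions of two variables are curried.  Since deriv is total, existence of a partial
   derivative is always stated separately, by field_differentiable. *)
definition pd1 :: "(real \<Rightarrow> real \<Rightarrow> real) \<Rightarrow> real \<Rightarrow> real \<Rightarrow> real" where
  "pd1 f x t = deriv (\<lambda>y. f y t) x"

definition pd2 :: "(real \<Rightarrow> real \<Rightarrow> real) \<Rightarrow> real \<Rightarrow> real \<Rightarrow> real" where
  "pd2 f x t = deriv (\<lambda>s. f x s) t"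

definition material_deriv ::
  "(real \<Rightarrow> real \<Rightarrow> real) \<Rightarrow> (real \<Rightarrow> real \<Rightarrow> real) \<Rightarrow> real \<Rightarrow> real \<Rightarrow> real" where
  "material_deriv u v x t = pd2 v x t + u x t * pd1 v x t"

(* All derivatives occurring in (v_t + u v_x)_x = 0 and u_xx = v_x^2 exist on W,
   and both equations hold there. *)
definition solves_system ::
  "(real \<Rightarrow> real \<Rightarrow> real) \<Rightarrow> (real \<Rightarrow> real \<Rightarrow> real) \<Rightarrow> (real \<times> real) set \<Rightarrow> bool" where
  "solves_system u v W \<longleftrightarrow>
     (\<forall>(x, t) \<in> W.
        (\<lambda>s. v x s) field_differentiable (at t) \<and>
        (\<lambda>y. v y t) field_differentiable (at x) \<and>
        (\<lambda>y. material_deriv u v y t) field_differentiable (at x) \<and>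
        (\<lambda>y. u y t) field_differentiable (at x) \<and>
        (\<lambda>y. pd1 u y t) field_differentiable (at x) \<and>
        pd1 (material_deriv u v) x t = 0 \<and>
        pd1 (pd1 u) x t = (pd1 v x t)\<^sup>2)"

definition coord_change :: "(real \<Rightarrow> real \<Rightarrow> real) \<Rightarrow> real \<times> real \<Rightarrow> real \<times> real" where
  "coord_change X = (\<lambda>(\<xi>, \<tau>). (X \<xi> \<tau>, \<tau>))"

(* The interval integral is oriented, so negative \<xi> is covered. *)
definition X_sol ::
  "(real \<Rightarrow> real) \<Rightarrow> (real \<Rightarrow> real) \<Rightarrow> (real \<Rightarrow> real) \<Rightarrow> (real \<Rightarrow> real) \<Rightarrow> real \<Rightarrow> real \<Rightarrow> real" where
  "X_sol A B F H \<xi> \<tau> =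
     - (LBINT s=ereal 0..ereal \<xi>. (deriv F s)\<^sup>2 * (A s + B \<tau>)\<^sup>2 / (2 * deriv A s * deriv B \<tau>)) + H \<tau>"

definition U_sol ::
  "(real \<Rightarrow> real) \<Rightarrow> (real \<Rightarrow> real) \<Rightarrow> (real \<Rightarrow> real) \<Rightarrow> (real \<Rightarrow> real) \<Rightarrow> real \<Rightarrow> real \<Rightarrow> real" where
  "U_sol A B F H = pd2 (X_sol A B F H)"

definition V_sol :: "(real \<Rightarrow> real) \<Rightarrow> (real \<Rightarrow> real) \<Rightarrow> real \<Rightarrow> real \<Rightarrow> real" where
  "V_sol F G \<xi> \<tau> = F \<xi> + G \<tau>"

end

(* In characteristic coordinates the operator d/dx is (1 / X_xi) d/dxi and d/dt + u d/dx is
   d/dtau.  Hence v_t + u v_x = G'(tau), which does not depend on xi, and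
   u_x = X_{xi tau} / X_xi = 2 B' / (A + B) - B'' / B'.  Dividing the xi-derivative of the latter
   by X_xi = - F'^2 (A + B)^2 / (2 A' B') gives (F' / X_xi)^2 = v_x^2. *)
theory Submission
  imports Defs
begin

section \<open>Antiderivatives on an open interval and derivatives of smooth functions\<close>

lemma Icc_subset_is_interval:
  fixes I :: "real set"
  assumes "is_interval I" "a \<in> I" "b \<in> I"
  shows "{a..b} \<subseteq> I"
  using mem_is_interval_1_I[OF assms] by (simp add: subset_iff)

text \<open>The oriented integral from \<open>c\<close> serves as \<open>P\<close>, on both sides of
  \<open>c\<close>. The normalisation \<open>P c = 0\<close> later matches the lower limit 0 of the
  integral in \<open>X_sol\<close>.\<close>

lemma interval_antiderivative_exists:
  fixes f :: "real \<Rightarrow> real"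
  assumes "open I" "is_interval I" "c \<in> I" "continuous_on I f"
  shows "\<exists>P. P c = 0 \<and> (\<forall>x\<in>I. (P has_real_derivative f x) (at x))"
proof (intro exI[of _ "\<lambda>u. LBINT y=ereal c..ereal u. f y"] conjI ballI)
  show "(LBINT y=ereal c..ereal c. f y) = 0"
    by simp
  fix x assume "x \<in> I"
  then have "min c x \<in> I" "max c x \<in> I"
    using \<open>c \<in> I\<close> by (auto simp: min_def max_def)
  obtain d where d: "d > 0" "cball (min c x) d \<subseteq> I"
    using open_contains_cball_eq[OF \<open>open I\<close>] \<open>min c x \<in> I\<close> by blast
  obtain e where e: "e > 0" "cball (max c x) e \<subseteq> I"
    using open_contains_cball_eq[OF \<open>open I\<close>] \<open>max c x \<in> I\<close> by blast
  \<comment> \<open>Stepping beyond \<open>c\<close> and \<open>x\<close> on both sides keeps [a, b]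
    inside \<open>I\<close> and puts \<open>x\<close> in its interior, so the derivative within
    [a, b] given by the fundamental theorem is a full derivative.\<close>
  define a where "a = min c x - d"
  define b where "b = max c x + e"
  have "a \<in> cball (min c x) d" "b \<in> cball (max c x) e"
    using d(1) e(1) by (simp_all add: a_def b_def dist_real_def)
  then have "a \<in> I" "b \<in> I"
    using d(2) e(2) by blast+
  then have "{a..b} \<subseteq> I"
    by (rule Icc_subset_is_interval[OF \<open>is_interval I\<close>])
  moreover have ab: "a \<le> c" "c \<le> b" "a < x" "x < b"
    using d(1) e(1) by (auto simp: a_def b_def)
  ultimately have "((\<lambda>u. LBINT y=ereal c..ereal u. f y) has_vector_derivative f x) (at x within {a..b})"
    using interval_integral_FTC2[of a c b f x] continuous_on_subset[OF assms(4)] by auto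
  moreover have "at x within {a..b} = at x"
    using ab by (intro at_within_interior) auto
  ultimately show "((\<lambda>u. LBINT y=ereal c..ereal u. f y) has_real_derivative f x) (at x)"
    by (simp add: has_real_derivative_iff_has_vector_derivative)
qed

lemma smooth_on_DERIV_funpow:
  assumes "smooth_on S f" "x \<in> S"
  shows "((deriv ^^ n) f has_real_derivative (deriv ^^ Suc n) f x) (at x)"
  using assms by (auto simp: smooth_on_def field_differentiable_derivI)

lemma smooth_on_DERIV:
  assumes "smooth_on S f" "x \<in> S"
  shows "(f has_real_derivative deriv f x) (at x)"
    and "(deriv f has_real_derivative deriv (deriv f) x) (at x)"
    and "(deriv (deriv f) has_real_derivative deriv (deriv (deriv f)) x) (at x)"
  using smooth_on_DERIV_funpow[OF assms, of 0] smooth_on_DERIV_funpow[OF assms, of 1]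
    smooth_on_DERIV_funpow[OF assms, of 2]
  by (simp_all add: numeral_2_eq_2)

section \<open>Partial derivatives and the change of variables in the plane\<close>

text \<open>Chain rule along the embeddings y to (y, t) and s to (x, s); a linear map on the reals
  is multiplication by its value at 1.\<close>

lemma DERIV_partial:
  fixes \<phi> :: "real \<Rightarrow> real \<Rightarrow> real"
  assumes "(case_prod \<phi> has_derivative D) (at (x, t))"
  shows "((\<lambda>y. \<phi> y t) has_real_derivative D (1, 0)) (at x)"
    and "((\<lambda>s. \<phi> x s) has_real_derivative D (0, 1)) (at t)"
proof -
  interpret bounded_linear D
    using assms by (rule has_derivative_bounded_linear)
  have "D (h, 0) = D (1, 0) * h" for h
    using scaleR[of h "(1, 0)"] unfolding scaleR_Pair real_scaleR_def mult_1_right mult_zero_right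
    by (rule trans) (rule mult.commute)
  moreover have "D (0, h) = D (0, 1) * h" for h
    using scaleR[of h "(0, 1)"] unfolding scaleR_Pair real_scaleR_def mult_1_right mult_zero_right
    by (rule trans) (rule mult.commute)
  ultimately have eq: "(\<lambda>h. D (h, 0)) = (*) (D (1, 0))" "(\<lambda>h. D (0, h)) = (*) (D (0, 1))"
    by blast+
  have "((\<lambda>y. (y, t)) has_derivative (\<lambda>h. (h, 0))) (at x)"
    by (intro has_derivative_Pair has_derivative_ident has_derivative_const)
  from has_derivative_compose[OF this assms]
  show "((\<lambda>y. \<phi> y t) has_real_derivative D (1, 0)) (at x)"
    by (simp only: has_field_derivative_def eq prod.case)
  have "((\<lambda>s. (x, s)) has_derivative (\<lambda>h. (0, h))) (at t)"
    by (intro has_derivative_Pair has_derivative_ident has_derivative_const)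
  from has_derivative_compose[OF this assms]
  show "((\<lambda>s. \<phi> x s) has_real_derivative D (0, 1)) (at t)"
    by (simp only: has_field_derivative_def eq prod.case)
qed

lemma differentiable_fst_snd:
  fixes f :: "real \<Rightarrow> real"
  shows "(f has_real_derivative d) (at x) \<Longrightarrow> (\<lambda>p. f (fst p)) differentiable (at (x, t))"
    and "(f has_real_derivative d) (at t) \<Longrightarrow> (\<lambda>p. f (snd p)) differentiable (at (x, t))"
  by (auto simp: differentiable_def
      intro!: exI DERIV_compose_FDERIV has_derivative_fst has_derivative_snd has_derivative_ident)

text \<open>Chain rule for \<open>w\<close> = \<open>\<phi>\<close> composed with the inverse of the
  coordinate change. The Jacobian matrix has rows (a, b) and (0, 1), hence determinant
  \<open>a\<close>, and inverting it turns d/dx into (1/a) d/d\<xi> and d/dt into d/d\<tau> - (b/a)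
  d/d\<xi>.\<close>

lemma DERIV_coord_change:
  fixes X \<phi> w :: "real \<Rightarrow> real \<Rightarrow> real"
  assumes S: "open S" "inj_on (coord_change X) S" "(x, t) \<in> S"
    and X: "\<And>p. p \<in> S \<Longrightarrow> case_prod X differentiable (at p)"
    and a: "((\<lambda>y. X y t) has_real_derivative a) (at x)" "a \<noteq> 0"
    and b: "((\<lambda>s. X x s) has_real_derivative b) (at t)"
    and w: "\<And>y s. (y, s) \<in> S \<Longrightarrow> w (X y s) s = \<phi> y s"
    and \<phi>: "case_prod \<phi> differentiable (at (x, t))"
    and p: "((\<lambda>y. \<phi> y t) has_real_derivative p) (at x)"
    and q: "((\<lambda>s. \<phi> x s) has_real_derivative q) (at t)"
  shows "((\<lambda>y. w y t) has_real_derivative p / a) (at (X x t))"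
    and "((\<lambda>s. w (X x t) s) has_real_derivative q - b * (p / a)) (at t)"
proof -
  let ?c = "coord_change X"
  define g where "g = inv_into S ?c"
  have g: "g (?c z) = z" if "z \<in> S" for z
    using that S(2) by (simp add: g_def)
  obtain DX where DX: "(case_prod X has_derivative DX) (at (x, t))"
    using X[OF S(3)] by (auto simp: differentiable_def)
  obtain D where D: "(case_prod \<phi> has_derivative D) (at (x, t))"
    using \<phi> by (auto simp: differentiable_def)
  have DX1: "DX (1, 0) = a" "DX (0, 1) = b"
    using DERIV_partial[OF DX] a b by (auto dest: DERIV_unique)
  have D1: "D (1, 0) = p" "D (0, 1) = q"
    using DERIV_partial[OF D] p q by (auto dest: DERIV_unique)
  have linear_plane: "L (h, k) = h * L (1, 0) + k * L (0, 1)"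
    if "linear L" for L :: "real \<times> real \<Rightarrow> real" and h k
    using linear_add[OF that, of "h *\<^sub>R (1, 0)" "k *\<^sub>R (0, 1)"]
      linear_scale[OF that, of h "(1, 0)"] linear_scale[OF that, of k "(0, 1)"] by auto
  have DX': "DX (h, k) = h * a + k * b" for h k
    using linear_plane[OF has_derivative_linear[OF DX]] DX1 by simp
  have D': "D (h, k) = h * p + k * q" for h k
    using linear_plane[OF has_derivative_linear[OF D]] D1 by simp
  have c_eq: "?c = (\<lambda>z. (case_prod X z, snd z))"
    by (auto simp: coord_change_def)
  have contX: "continuous_on S (case_prod X)"
    using X differentiable_imp_continuous_within
    by (force simp: continuous_on_eq_continuous_at[OF S(1)])
  have cont: "continuous_on S ?c"
    unfolding c_eq by (intro continuous_intros contX)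
  have c': "(?c has_derivative (\<lambda>h. (DX h, snd h))) (at (x, t))"
    unfolding c_eq by (intro derivative_intros DX)
  \<comment> \<open>The candidate derivative solves \<open>h * a + k * b = m\<close> for
    \<open>h\<close> with \<open>k\<close> kept fixed. Injectivity makes \<open>g\<close> a left
    inverse on all of \<open>S\<close>, so differentiability at the one point is combined with
    continuity on \<open>S\<close>.\<close>
  have "(g has_derivative (\<lambda>h. ((fst h - snd h * b) / a, snd h))) (at (?c (x, t)))"
    by (rule has_derivative_inverse_strong[OF S(1,3) cont _ c'])
      (use g a(2) in \<open>auto simp: fun_eq_iff DX'\<close>)
  then have "((\<lambda>z. case_prod \<phi> (g z)) has_derivative
      (\<lambda>h. D ((fst h - snd h * b) / a, snd h))) (at (?c (x, t)))"
    by (rule has_derivative_compose) (use D g[OF S(3)] in simp)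
  then have "(case_prod w has_derivative
      (\<lambda>h. D ((fst h - snd h * b) / a, snd h))) (at (?c (x, t)))"
  proof (rule has_derivative_transform_within_open)
    \<comment> \<open>\<open>w\<close> is known only on the image of \<open>S\<close>; invariance of
      domain makes this image a neighbourhood of the point, so the derivative carries over.\<close>
    show "open (?c ` S)"
      using cont S by (simp add: invariance_of_domain)
    show "case_prod \<phi> (g z) = case_prod w z" if "z \<in> ?c ` S" for z
      using that g w by (auto simp: coord_change_def)
  qed (use S in auto)
  from DERIV_partial[OF this[unfolded coord_change_def prod.case]]
  show "((\<lambda>y. w y t) has_real_derivative p / a) (at (X x t))"
    and "((\<lambda>s. w (X x t) s) has_real_derivative q - b * (p / a)) (at t)"
    by (simp_all add: D' algebra_simps)
qed

section \<open>The integral defining \<open>X_sol\<close> in closed form\<close>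

text \<open>Expanding \<open>(A + B)\<^sup>2\<close> moves the dependence on \<open>\<tau>\<close> out of the integral, so that
  no differentiation under the integral sign is needed.\<close>

lemma X_sol_closed_form:
  assumes I: "open I" "is_interval I" "0 \<in> I"
    and A: "smooth_on I A" "\<And>\<xi>. \<xi> \<in> I \<Longrightarrow> deriv A \<xi> \<noteq> 0"
    and F: "smooth_on I F"
  obtains P0 P1 P2 where
    "\<And>\<xi>. \<xi> \<in> I \<Longrightarrow> (P0 has_real_derivative (deriv F \<xi>)\<^sup>2 / deriv A \<xi> * (A \<xi>)\<^sup>2) (at \<xi>)"
    "\<And>\<xi>. \<xi> \<in> I \<Longrightarrow> (P1 has_real_derivative (deriv F \<xi>)\<^sup>2 / deriv A \<xi> * A \<xi>) (at \<xi>)"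
    "\<And>\<xi>. \<xi> \<in> I \<Longrightarrow> (P2 has_real_derivative (deriv F \<xi>)\<^sup>2 / deriv A \<xi>) (at \<xi>)"
    "\<And>\<xi> \<tau> B H. \<xi> \<in> I \<Longrightarrow> X_sol A B F H \<xi> \<tau> =
        H \<tau> - (P0 \<xi> + 2 * P1 \<xi> * B \<tau> + P2 \<xi> * (B \<tau>)\<^sup>2) / (2 * deriv B \<tau>)"
proof -
  have cont: "continuous_on I A" "continuous_on I (deriv A)" "continuous_on I (deriv F)"
    by (rule DERIV_continuous_on, rule has_field_derivative_at_within,
        rule smooth_on_DERIV[OF A(1)] smooth_on_DERIV[OF F], assumption)+
  have cont': "continuous_on I (\<lambda>\<xi>. (deriv F \<xi>)\<^sup>2 / deriv A \<xi> * (A \<xi>)\<^sup>2)"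
    "continuous_on I (\<lambda>\<xi>. (deriv F \<xi>)\<^sup>2 / deriv A \<xi> * A \<xi>)"
    "continuous_on I (\<lambda>\<xi>. (deriv F \<xi>)\<^sup>2 / deriv A \<xi>)"
    by (intro continuous_on_mult continuous_on_divide continuous_on_power cont ballI A(2); assumption)+
  \<comment> \<open>Antiderivatives for the powers of \<open>B \<tau>\<close> in the expanded
    square: \<open>P0\<close> for the constant term, \<open>P1\<close> for half of the linear one,
    \<open>P2\<close> for the quadratic one. As they vanish at 0, the lower limit contributes
    nothing.\<close>
  obtain P0 where P0: "P0 0 = 0"
    "\<And>\<xi>. \<xi> \<in> I \<Longrightarrow> (P0 has_real_derivative (deriv F \<xi>)\<^sup>2 / deriv A \<xi> * (A \<xi>)\<^sup>2) (at \<xi>)"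
    using interval_antiderivative_exists[OF I cont'(1)] by metis
  obtain P1 where P1: "P1 0 = 0"
    "\<And>\<xi>. \<xi> \<in> I \<Longrightarrow> (P1 has_real_derivative (deriv F \<xi>)\<^sup>2 / deriv A \<xi> * A \<xi>) (at \<xi>)"
    using interval_antiderivative_exists[OF I cont'(2)] by metis
  obtain P2 where P2: "P2 0 = 0"
    "\<And>\<xi>. \<xi> \<in> I \<Longrightarrow> (P2 has_real_derivative (deriv F \<xi>)\<^sup>2 / deriv A \<xi>) (at \<xi>)"
    using interval_antiderivative_exists[OF I cont'(3)] by metis
  have "X_sol A B F H \<xi> \<tau> =
      H \<tau> - (P0 \<xi> + 2 * P1 \<xi> * B \<tau> + P2 \<xi> * (B \<tau>)\<^sup>2) / (2 * deriv B \<tau>)"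
    if "\<xi> \<in> I" for \<xi> \<tau> B H
  proof -
    let ?f = "\<lambda>s. (deriv F s)\<^sup>2 * (A s + B \<tau>)\<^sup>2 / (2 * deriv A s * deriv B \<tau>)"
    let ?P = "\<lambda>s. (P0 s + 2 * P1 s * B \<tau> + P2 s * (B \<tau>)\<^sup>2) / (2 * deriv B \<tau>)"
    have "min 0 \<xi> \<in> I" "max 0 \<xi> \<in> I"
      using I(3) that by (auto simp: min_def max_def)
    then have sub: "{min 0 \<xi>..max 0 \<xi>} \<subseteq> I"
      by (rule Icc_subset_is_interval[OF I(2)])
    have split: "?f s = ((deriv F s)\<^sup>2 / deriv A s * (A s)\<^sup>2 + 2 * ((deriv F s)\<^sup>2 / deriv A s * A s) * B \<tau>
        + (deriv F s)\<^sup>2 / deriv A s * (B \<tau>)\<^sup>2) / (2 * deriv B \<tau>)" if "s \<in> I" for s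
    proof -
      \<comment> \<open>Here \<open>l\<close> stands for \<open>deriv B \<tau>\<close>, which may be
        zero since \<open>B\<close> and \<open>\<tau>\<close> are arbitrary; both sides are then 0
        because division by zero yields 0.\<close>
      have *: "f\<^sup>2 * (a + b)\<^sup>2 / (2 * k * l) =
          (f\<^sup>2 / k * a\<^sup>2 + 2 * (f\<^sup>2 / k * a) * b + f\<^sup>2 / k * b\<^sup>2) / (2 * l)"
        if "k \<noteq> 0" for f a b k l :: real
        using that by (cases "l = 0") (simp_all add: field_simps power2_eq_square)
      show ?thesis
        by (rule *) (rule A(2)[OF that])
    qed
    have P': "(?P has_real_derivative ?f s) (at s)" if "s \<in> I" for s
      unfolding split[OF that]
      by (intro DERIV_cdivide DERIV_add DERIV_cmult DERIV_cmult_right P0(2) P1(2) P2(2) that)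
    have f': "continuous_on I ?f"
    proof -
      \<comment> \<open>With \<open>deriv B \<tau>\<close> moved into the constant factor
        \<open>inverse (2 * deriv B \<tau>)\<close>, the only genuine division is by
        \<open>deriv A\<close>, which does not vanish on \<open>I\<close>.\<close>
      have "continuous_on I (\<lambda>s. (deriv F s)\<^sup>2 / deriv A s * (A s + B \<tau>)\<^sup>2 * inverse (2 * deriv B \<tau>))"
        by (intro continuous_on_mult continuous_on_divide continuous_on_power continuous_on_add
            continuous_on_const cont ballI A(2); (assumption | simp))
      then show ?thesis
        by (rule continuous_on_eq) (simp add: field_simps)
    qed
    have "(LBINT s=ereal 0..ereal \<xi>. ?f s) = ?P \<xi> - ?P 0"
    proof (rule interval_integral_FTC_finite)
      show "continuous_on {min 0 \<xi>..max 0 \<xi>} ?f"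
        using f' sub by (rule continuous_on_subset)
      show "(?P has_vector_derivative ?f s) (at s within {min 0 \<xi>..max 0 \<xi>})"
        if "min 0 \<xi> \<le> s" "s \<le> max 0 \<xi>" for s
      proof -
        have "s \<in> I"
          using sub that by auto
        from P'[OF this] show ?thesis
          unfolding has_real_derivative_iff_has_vector_derivative
          by (rule has_vector_derivative_at_within)
      qed
    qed
    then show ?thesis
      by (simp add: X_sol_def P0(1) P1(1) P2(1))
  qed
  from that[OF P0(2) P1(2) P2(2) this] show thesis .
qed

section \<open>The solution formula\<close>

theorem proposition2:
  fixes A F B G H :: "real \<Rightarrow> real" and I J :: "real set"
  assumes "open I" and "is_interval I" and "0 \<in> I"
    and "open J" and "is_interval J"
    and "smooth_on I A" and "smooth_on I F"
    and "smooth_on J B" and "smooth_on J G" and "smooth_on J H"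
    and "\<And>\<xi>. \<xi> \<in> I \<Longrightarrow> deriv A \<xi> \<noteq> 0"
    and "\<And>\<tau>. \<tau> \<in> J \<Longrightarrow> deriv B \<tau> \<noteq> 0"
    and "\<And>\<xi> \<tau>. \<xi> \<in> I \<Longrightarrow> \<tau> \<in> J \<Longrightarrow> pd1 (X_sol A B F H) \<xi> \<tau> \<noteq> 0"
  shows "inj_on (coord_change (X_sol A B F H)) (I \<times> J) \<and>
    open (coord_change (X_sol A B F H) ` (I \<times> J)) \<and>
    (\<forall>u v :: real \<Rightarrow> real \<Rightarrow> real.
       (\<forall>\<xi>\<in>I. \<forall>\<tau>\<in>J. u (X_sol A B F H \<xi> \<tau>) \<tau> = U_sol A B F H \<xi> \<tau> \<and>
                     v (X_sol A B F H \<xi> \<tau>) \<tau> = V_sol F G \<xi> \<tau>) \<longrightarrow>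
       (\<forall>\<xi>\<in>I. \<forall>\<tau>\<in>J. ((\<lambda>s. X_sol A B F H \<xi> s) has_real_derivative
                        u (X_sol A B F H \<xi> \<tau>) \<tau>) (at \<tau>)) \<and>
       solves_system u v (coord_change (X_sol A B F H) ` (I \<times> J)))"
proof -
  note A = smooth_on_DERIV[OF \<open>smooth_on I A\<close>] and F = smooth_on_DERIV[OF \<open>smooth_on I F\<close>]
    and B = smooth_on_DERIV[OF \<open>smooth_on J B\<close>] and G = smooth_on_DERIV[OF \<open>smooth_on J G\<close>]
    and H = smooth_on_DERIV[OF \<open>smooth_on J H\<close>]
  note dA = assms(11) and dB = assms(12)
  define A1 A2 B1 B2 B3 F1 F2 G1 G2 H1 H2 where defs:
    "A1 = deriv A" "A2 = deriv A1" "B1 = deriv B" "B2 = deriv B1" "B3 = deriv B2"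
    "F1 = deriv F" "F2 = deriv F1" "G1 = deriv G" "G2 = deriv G1" "H1 = deriv H" "H2 = deriv H1"
  note A = A[folded defs] and F = F[folded defs] and B = B[folded defs] and G = G[folded defs]
    and H = H[folded defs] and dA = dA[folded defs] and dB = dB[folded defs]
  obtain P0 P1 P2 where P:
    "\<And>\<xi>. \<xi> \<in> I \<Longrightarrow> (P0 has_real_derivative (F1 \<xi>)\<^sup>2 / A1 \<xi> * (A \<xi>)\<^sup>2) (at \<xi>)"
    "\<And>\<xi>. \<xi> \<in> I \<Longrightarrow> (P1 has_real_derivative (F1 \<xi>)\<^sup>2 / A1 \<xi> * A \<xi>) (at \<xi>)"
    "\<And>\<xi>. \<xi> \<in> I \<Longrightarrow> (P2 has_real_derivative (F1 \<xi>)\<^sup>2 / A1 \<xi>) (at \<xi>)"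
    and X_sol: "\<And>\<xi> \<tau> B H. \<xi> \<in> I \<Longrightarrow> X_sol A B F H \<xi> \<tau> =
        H \<tau> - (P0 \<xi> + 2 * P1 \<xi> * B \<tau> + P2 \<xi> * (B \<tau>)\<^sup>2) / (2 * deriv B \<tau>)"
    using X_sol_closed_form[of I A F] assms by (metis defs)
  \<comment> \<open>\<open>X\<close> is the closed form of \<open>X_sol\<close>, \<open>U\<close>
    its \<tau>-derivative and \<open>a\<close> its \<xi>-derivative. In \<open>U\<close>,
    differentiating the numerator gives
    \<open>2 * (P1 \<xi> + P2 \<xi> * B \<tau>) * B1 \<tau>\<close>, whose factor
    \<open>2 * B1 \<tau>\<close> cancels against the denominator.\<close>
  define X where "X \<xi> \<tau> = H \<tau> - (P0 \<xi> + 2 * P1 \<xi> * B \<tau> + P2 \<xi> * (B \<tau>)\<^sup>2) / (2 * B1 \<tau>)" for \<xi> \<tau>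
  define U where "U \<xi> \<tau> = H1 \<tau> - (P1 \<xi> + P2 \<xi> * B \<tau>) +
      (P0 \<xi> + 2 * P1 \<xi> * B \<tau> + P2 \<xi> * (B \<tau>)\<^sup>2) * B2 \<tau> / (2 * (B1 \<tau>)\<^sup>2)" for \<xi> \<tau>
  define a where "a \<xi> \<tau> = - ((F1 \<xi>)\<^sup>2 * (A \<xi> + B \<tau>)\<^sup>2 / (2 * A1 \<xi> * B1 \<tau>))" for \<xi> \<tau>
  have X_eq: "X_sol A B F H \<xi> \<tau> = X \<xi> \<tau>" if "\<xi> \<in> I" for \<xi> \<tau>
    using that by (simp add: X_sol X_def defs)
  have Xx: "((\<lambda>y. X y \<tau>) has_real_derivative a \<xi> \<tau>) (at \<xi>)" if "\<xi> \<in> I" "\<tau> \<in> J" for \<xi> \<tau>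
  proof -
    have "((\<lambda>y. X y \<tau>) has_real_derivative 0 - ((F1 \<xi>)\<^sup>2 / A1 \<xi> * (A \<xi>)\<^sup>2
        + 2 * ((F1 \<xi>)\<^sup>2 / A1 \<xi> * A \<xi>) * B \<tau> + (F1 \<xi>)\<^sup>2 / A1 \<xi> * (B \<tau>)\<^sup>2) / (2 * B1 \<tau>)) (at \<xi>)"
      unfolding X_def
      by (intro DERIV_diff DERIV_const DERIV_cdivide DERIV_add DERIV_cmult DERIV_cmult_right P that)
    then show ?thesis
      by (rule DERIV_cong)
        (use dA[OF that(1)] dB[OF that(2)] in \<open>simp add: a_def field_simps power2_eq_square\<close>)
  qed
  have Xt: "((\<lambda>s. X \<xi> s) has_real_derivative U \<xi> \<tau>) (at \<tau>)" if "\<tau> \<in> J" for \<xi> \<tau>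
  proof -
    have nz: "2 * B1 \<tau> \<noteq> 0"
      using dB[OF that] by simp
    show ?thesis
      unfolding X_def U_def
      by (rule derivative_eq_intros B H that nz refl)+
        (use nz in \<open>simp add: field_simps power2_eq_square\<close>)
  qed
  have a0: "a \<xi> \<tau> \<noteq> 0" if "\<xi> \<in> I" "\<tau> \<in> J" for \<xi> \<tau>
  proof -
    have "((\<lambda>y. X_sol A B F H y \<tau>) has_real_derivative a \<xi> \<tau>) (at \<xi>)"
      using Xx[OF that] \<open>open I\<close> that(1)
      by (rule has_field_derivative_transform_within_open) (simp add: X_eq)
    then show ?thesis
      using assms(13)[OF that] by (auto simp: pd1_def DERIV_imp_deriv)
  qed
  \<comment> \<open>\<open>F1 \<xi>\<close> and \<open>A \<xi> + B \<tau>\<close> are factors of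
    \<open>a \<xi> \<tau>\<close>, so invertibility of the coordinate change excludes their
    zeros.\<close>
  have F0: "F1 \<xi> \<noteq> 0" and AB: "A \<xi> + B \<tau> \<noteq> 0" if "\<xi> \<in> I" "\<tau> \<in> J" for \<xi> \<tau>
    using a0[OF that] by (auto simp: a_def)

  \<comment> \<open>Injectivity, differentiability and openness of the coordinate change\<close>
  let ?S = "I \<times> J"
  have c_eq: "coord_change (X_sol A B F H) p = coord_change X p" if "p \<in> ?S" for p
    using that by (auto simp: coord_change_def X_eq)
  have inj: "inj_on (coord_change X) ?S"
  proof -
    \<comment> \<open>Points with equal images share \<open>\<tau>\<close>, so only two values of
      \<xi> need comparing; by the mean value theorem a coincidence would force a zero of
      \<open>a\<close> between them.\<close>
    have "X y \<tau> \<noteq> X z \<tau>" if "y \<in> I" "z \<in> I" "\<tau> \<in> J" "y < z" for y z \<tau>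
    proof
      assume eq: "X y \<tau> = X z \<tau>"
      have sub: "{y..z} \<subseteq> I"
        using that by (intro Icc_subset_is_interval[OF \<open>is_interval I\<close>])
      obtain \<xi> where "y < \<xi>" "\<xi> < z" "X z \<tau> - X y \<tau> = (z - y) * a \<xi> \<tau>"
        using MVT2[OF \<open>y < z\<close>, of "\<lambda>y. X y \<tau>" "\<lambda>\<xi>. a \<xi> \<tau>"] Xx sub \<open>\<tau> \<in> J\<close> by (auto simp: subset_iff)
      moreover from this have "\<xi> \<in> I"
        using sub by (auto simp: subset_iff)
      ultimately show False
        using a0[of \<xi> \<tau>] \<open>\<tau> \<in> J\<close> eq \<open>y < z\<close> by auto
    qed
    then show ?thesis
      by (auto simp: inj_on_def coord_change_def) (metis linorder_neqE_linordered_idom)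
  qed
  have opS: "open ?S"
    using \<open>open I\<close> \<open>open J\<close> by (rule open_Times)
  \<comment> \<open>The closed form is built from one-variable functions of \<xi> or of \<tau>, so
    joint differentiability follows from theirs.\<close>
  have diffX: "case_prod X differentiable (at p)" if "p \<in> ?S" for p
  proof -
    obtain \<xi> \<tau> where p: "p = (\<xi>, \<tau>)" "\<xi> \<in> I" "\<tau> \<in> J"
      using \<open>p \<in> ?S\<close> by blast
    show ?thesis
      unfolding X_def split_def p(1)
      by (intro derivative_intros differentiable_fst_snd(1)[OF P(1)] differentiable_fst_snd(1)[OF P(2)]
          differentiable_fst_snd(1)[OF P(3)] differentiable_fst_snd(2)[OF B(1)]
          differentiable_fst_snd(2)[OF B(2)] differentiable_fst_snd(2)[OF H(1)] p(2,3))
        (use dB[OF p(3)] in auto)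
  qed
  have "continuous_on ?S (case_prod X)"
    using diffX differentiable_imp_continuous_within
    by (force simp: continuous_on_eq_continuous_at[OF opS])
  then have "continuous_on ?S (\<lambda>z. (case_prod X z, snd z))"
    by (intro continuous_intros)
  then have "continuous_on ?S (coord_change X)"
    by (rule continuous_on_eq) (auto simp: coord_change_def)
  then have op: "open (coord_change X ` ?S)"
    using opS inj by (rule invariance_of_domain)

  \<comment> \<open>The two equations of the system\<close>
  have pde: "solves_system u v (coord_change X ` ?S)"
    if u: "\<And>\<xi> \<tau>. (\<xi>, \<tau>) \<in> ?S \<Longrightarrow> u (X \<xi> \<tau>) \<tau> = U \<xi> \<tau>"
      and v: "\<And>\<xi> \<tau>. (\<xi>, \<tau>) \<in> ?S \<Longrightarrow> v (X \<xi> \<tau>) \<tau> = F \<xi> + G \<tau>" for u v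
  proof -
    note D = DERIV_coord_change[OF opS inj _ diffX Xx a0 Xt]
    \<comment> \<open>\<open>M\<close> is u_x and \<open>N\<close> is v_x, expressed in (\<xi>,
      \<tau>). \<open>M\<close> is the logarithmic \<tau>-derivative of \<open>a\<close>, which
      depends on \<tau> through (A + B)^2 / B'.\<close>
    define M where "M \<xi> \<tau> = 2 * B1 \<tau> / (A \<xi> + B \<tau>) - B2 \<tau> / B1 \<tau>" for \<xi> \<tau>
    define N where "N \<xi> \<tau> = F1 \<xi> / a \<xi> \<tau>" for \<xi> \<tau>
    have ux: "((\<lambda>y. u y \<tau>) has_real_derivative M \<xi> \<tau>) (at (X \<xi> \<tau>))"
      if "\<xi> \<in> I" "\<tau> \<in> J" for \<xi> \<tau>
    proof -
      \<comment> \<open>The \<xi>-derivative of \<open>U\<close>, with the expanded square collected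
        again so that powers of \<open>A \<xi> + B \<tau>\<close> cancel against
        \<open>a\<close>.\<close>
      define Ux where "Ux = - ((F1 \<xi>)\<^sup>2 / A1 \<xi> * (A \<xi> + B \<tau>)) +
        (F1 \<xi>)\<^sup>2 / A1 \<xi> * (A \<xi> + B \<tau>)\<^sup>2 * B2 \<tau> / (2 * (B1 \<tau>)\<^sup>2)"
      have "case_prod U differentiable (at (\<xi>, \<tau>))"
        unfolding U_def split_def
        by (intro derivative_intros differentiable_fst_snd(1)[OF P(1)] differentiable_fst_snd(1)[OF P(2)]
            differentiable_fst_snd(1)[OF P(3)] differentiable_fst_snd(2)[OF B(1)]
            differentiable_fst_snd(2)[OF B(2)] differentiable_fst_snd(2)[OF B(3)]
            differentiable_fst_snd(2)[OF H(2)] that)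
          (use dB[OF that(2)] in auto)
      \<comment> \<open>\<open>D\<close> takes a \<tau>-derivative as input, but its value does not
        enter the x-derivative; joint differentiability provides one without a formula.\<close>
      moreover from this obtain q where "((\<lambda>s. U \<xi> s) has_real_derivative q) (at \<tau>)"
        using DERIV_partial(2) by (metis differentiable_def)
      moreover have "((\<lambda>y. U y \<tau>) has_real_derivative Ux) (at \<xi>)"
      proof -
        have "((\<lambda>y. U y \<tau>) has_real_derivative
            0 - ((F1 \<xi>)\<^sup>2 / A1 \<xi> * A \<xi> + (F1 \<xi>)\<^sup>2 / A1 \<xi> * B \<tau>)
            + ((F1 \<xi>)\<^sup>2 / A1 \<xi> * (A \<xi>)\<^sup>2 + 2 * ((F1 \<xi>)\<^sup>2 / A1 \<xi> * A \<xi>) * B \<tau>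
              + (F1 \<xi>)\<^sup>2 / A1 \<xi> * (B \<tau>)\<^sup>2) * B2 \<tau> / (2 * (B1 \<tau>)\<^sup>2)) (at \<xi>)"
          unfolding U_def
          by (intro DERIV_diff DERIV_const DERIV_cdivide DERIV_add DERIV_cmult DERIV_cmult_right P that)
        then show ?thesis
          by (rule DERIV_cong)
            (use dA[OF that(1)] dB[OF that(2)] in \<open>simp add: Ux_def field_simps power2_eq_square\<close>)
      qed
      ultimately have "((\<lambda>y. u y \<tau>) has_real_derivative Ux / a \<xi> \<tau>) (at (X \<xi> \<tau>))"
        using D(1)[where \<phi> = U and w = u] u that by blast
      moreover have "Ux / a \<xi> \<tau> = M \<xi> \<tau>"
        using F0[OF that] AB[OF that] dA[OF that(1)] dB[OF that(2)]
        unfolding Ux_def a_def M_def by (simp add: divide_simps) algebra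
      ultimately show ?thesis
        by simp
    qed
    have uxx: "((\<lambda>y. pd1 u y \<tau>) has_real_derivative (N \<xi> \<tau>)\<^sup>2) (at (X \<xi> \<tau>))"
      if "\<xi> \<in> I" "\<tau> \<in> J" for \<xi> \<tau>
    proof -
      \<comment> \<open>The \<xi>-derivative of \<open>M\<close>; the term B'' / B' is free of \<xi>
        and drops out. The coordinate change is then applied a second time, with
        \<open>pd1 u\<close> as the transported function.\<close>
      define Mx where "Mx = - (2 * B1 \<tau> * A1 \<xi>) / (A \<xi> + B \<tau>)\<^sup>2"
      have "case_prod M differentiable (at (\<xi>, \<tau>))"
        unfolding M_def split_def
        by (intro derivative_intros differentiable_fst_snd(1)[OF A(1)] differentiable_fst_snd(2)[OF B(1)]
            differentiable_fst_snd(2)[OF B(2)] differentiable_fst_snd(2)[OF B(3)] that)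
          (use dB[OF that(2)] AB[OF that] in auto)
      moreover from this obtain q where "((\<lambda>s. M \<xi> s) has_real_derivative q) (at \<tau>)"
        using DERIV_partial(2) by (metis differentiable_def)
      moreover have "((\<lambda>y. M y \<tau>) has_real_derivative Mx) (at \<xi>)"
        unfolding M_def Mx_def
        by (rule derivative_eq_intros A AB dB that refl)+
          (use AB[OF that] dB[OF that(2)] in \<open>auto simp: field_simps power2_eq_square\<close>)
      moreover have "\<And>y s. (y, s) \<in> ?S \<Longrightarrow> pd1 u (X y s) s = M y s"
        using ux by (auto simp: pd1_def intro!: DERIV_imp_deriv)
      ultimately have "((\<lambda>y. pd1 u y \<tau>) has_real_derivative Mx / a \<xi> \<tau>) (at (X \<xi> \<tau>))"
        using D(1)[where \<phi> = M and w = "pd1 u"] that by blast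
      moreover have "Mx / a \<xi> \<tau> = (N \<xi> \<tau>)\<^sup>2"
      proof -
        \<comment> \<open>Both sides equal 4 b^2 k^2 / (f^2 c^4).\<close>
        have "- (2 * b * k) / c\<^sup>2 / - (f\<^sup>2 * c\<^sup>2 / (2 * k * b)) = (f / - (f\<^sup>2 * c\<^sup>2 / (2 * k * b)))\<^sup>2"
          if "f \<noteq> 0" "c \<noteq> 0" "k \<noteq> 0" "b \<noteq> 0" for f c k b :: real
          using that by (simp add: field_simps power2_eq_square)
        from this[OF F0[OF that] AB[OF that] dA[OF that(1)] dB[OF that(2)]] show ?thesis
          unfolding Mx_def a_def N_def .
      qed
      ultimately show ?thesis
        by simp
    qed
    have vx: "((\<lambda>y. v y \<tau>) has_real_derivative N \<xi> \<tau>) (at (X \<xi> \<tau>))"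
      and vt: "((\<lambda>s. v (X \<xi> \<tau>) s) has_real_derivative G1 \<tau> - U \<xi> \<tau> * N \<xi> \<tau>) (at \<tau>)"
      if "\<xi> \<in> I" "\<tau> \<in> J" for \<xi> \<tau>
    proof -
      have "case_prod (\<lambda>\<xi> \<tau>. F \<xi> + G \<tau>) differentiable (at (\<xi>, \<tau>))"
        unfolding split_def
        by (intro derivative_intros differentiable_fst_snd(1)[OF F(1)] differentiable_fst_snd(2)[OF G(1)] that)
      moreover have "((\<lambda>y. F y + G \<tau>) has_real_derivative F1 \<xi>) (at \<xi>)"
        "((\<lambda>s. F \<xi> + G s) has_real_derivative G1 \<tau>) (at \<tau>)"
        by (auto intro!: derivative_eq_intros F G that)
      ultimately show "((\<lambda>y. v y \<tau>) has_real_derivative N \<xi> \<tau>) (at (X \<xi> \<tau>))"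
        "((\<lambda>s. v (X \<xi> \<tau>) s) has_real_derivative G1 \<tau> - U \<xi> \<tau> * N \<xi> \<tau>) (at \<tau>)"
        unfolding N_def using D[where \<phi> = "\<lambda>\<xi> \<tau>. F \<xi> + G \<tau>" and w = v] v that by blast+
    qed
    have mat: "((\<lambda>y. material_deriv u v y \<tau>) has_real_derivative 0) (at (X \<xi> \<tau>))"
      if "\<xi> \<in> I" "\<tau> \<in> J" for \<xi> \<tau>
    proof -
      have "case_prod (\<lambda>\<xi> \<tau>. G1 \<tau>) differentiable (at (\<xi>, \<tau>))"
        unfolding split_def by (intro differentiable_fst_snd(2)[OF G(2)] that)
      moreover have "((\<lambda>y. G1 \<tau>) has_real_derivative 0) (at \<xi>)"
        "((\<lambda>s. G1 s) has_real_derivative G2 \<tau>) (at \<tau>)"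
        by (auto intro!: G that)
      \<comment> \<open>The term \<open>- U \<xi> \<tau> * N \<xi> \<tau>\<close> in v_t comes from
        X_\<tau> = U and cancels against u v_x, leaving \<open>G1\<close>.\<close>
      moreover have "material_deriv u v (X y s) s = G1 s" if "(y, s) \<in> ?S" for y s
        using vx[of y s] vt[of y s] u[OF that] that
        by (auto simp: material_deriv_def pd1_def pd2_def dest!: DERIV_imp_deriv)
      ultimately have "((\<lambda>y. material_deriv u v y \<tau>) has_real_derivative 0 / a \<xi> \<tau>) (at (X \<xi> \<tau>))"
        using D(1)[where \<phi> = "\<lambda>\<xi> \<tau>. G1 \<tau>" and w = "material_deriv u v"] that by blast
      then show ?thesis
        by simp
    qed
    have "v (X \<xi> \<tau>) field_differentiable (at \<tau>) \<and>
        (\<lambda>y. v y \<tau>) field_differentiable (at (X \<xi> \<tau>)) \<and>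
        (\<lambda>y. material_deriv u v y \<tau>) field_differentiable (at (X \<xi> \<tau>)) \<and>
        (\<lambda>y. u y \<tau>) field_differentiable (at (X \<xi> \<tau>)) \<and>
        (\<lambda>y. pd1 u y \<tau>) field_differentiable (at (X \<xi> \<tau>)) \<and>
        pd1 (material_deriv u v) (X \<xi> \<tau>) \<tau> = 0 \<and>
        pd1 (pd1 u) (X \<xi> \<tau>) \<tau> = (pd1 v (X \<xi> \<tau>) \<tau>)\<^sup>2"
      if m: "\<xi> \<in> I" "\<tau> \<in> J" for \<xi> \<tau>
    proof (intro conjI)
      show "pd1 (material_deriv u v) (X \<xi> \<tau>) \<tau> = 0"
        unfolding pd1_def by (rule DERIV_imp_deriv[OF mat[OF m]])
      show "pd1 (pd1 u) (X \<xi> \<tau>) \<tau> = (pd1 v (X \<xi> \<tau>) \<tau>)\<^sup>2"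
        using DERIV_imp_deriv[OF uxx[OF m]] DERIV_imp_deriv[OF vx[OF m]] by (simp add: pd1_def)
    qed (use ux[OF m] uxx[OF m] vx[OF m] vt[OF m] mat[OF m] in \<open>auto simp: field_differentiable_def\<close>)
    then show ?thesis
      unfolding solves_system_def coord_change_def by fastforce
  qed
  \<comment> \<open>\<open>X_eq\<close> holds for every real \<tau>, also outside \<open>J\<close>,
    so for fixed \<open>\<xi>\<close> the two sides are the same function of \<open>s\<close> and
    have the same derivative. This identifies \<open>U_sol\<close> with \<open>U\<close>.\<close>
  have Xt': "((\<lambda>s. X_sol A B F H \<xi> s) has_real_derivative U \<xi> \<tau>) (at \<tau>)" if "\<xi> \<in> I" "\<tau> \<in> J" for \<xi> \<tau>
    using Xt[OF that(2)] by (simp add: X_eq[OF that(1)])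
  then have U_eq: "U_sol A B F H \<xi> \<tau> = U \<xi> \<tau>" if "\<xi> \<in> I" "\<tau> \<in> J" for \<xi> \<tau>
    using that by (auto simp: U_sol_def pd2_def intro!: DERIV_imp_deriv)
  have img: "coord_change (X_sol A B F H) ` ?S = coord_change X ` ?S"
    by (rule image_cong[OF refl c_eq])
  have inj': "inj_on (coord_change (X_sol A B F H)) ?S"
    using inj c_eq by (subst inj_on_cong[OF c_eq])
  show ?thesis
    unfolding img
    using inj' op Xt' U_eq pde by (simp add: X_eq V_sol_def)
qed

end
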